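(* Let $L\subseteq L_\beta$ be a sublattice with $\operatorname{rank} L=n$, let $d_1,\dots,d_n$ be the invariant factors of the group $L_\beta/L$, and for each $i\in\{1,\dots,n\}$ let $C_i=\{c\in\mathbb K^* : c^{d_i}=1\}$ be the group of $d_i$-th roots of unity lying inside $\mathbb K$. Then $V_{X(\mathbb K)}(I_L)\cong C_1\times\cdots\times C_n$, and thus the number of $\mathbb K$-rational points $|V_{X(\mathbb K)}(I_L)|$ is $|C_1|\cdots|C_n|\le d_1\cdots d_n$. Moreover, $|V_{X(\mathbb K)}(I_L)|=d_1\cdots d_n$ if and only if $\mathbb K$ has all the $d_i$-th roots of unity, for every $i\in\{1,\dots,n\}$.
   Context: $\mathbb K$ is a field with algebraic closure $\overline{\mathbb K}$. $\Sigma$ is a complete simplicial fan in $\mathbb R^n$ with rays $\rho_1,\dots,\rho_r$ generated by primitive lattice vectors $\mathbf v_1,\dots,\mathbf v_r\in\mathbb Z^n$, and $X=X_\Sigma$ is the corresponding split toric variety over $\mathbb K$; its class group $\operatorname{Cl}X$ is assumed to be free. Let $\phi:\mathbb Z^n\to\mathbb Z^r$ be the $r\times n$ matrix with rows $\mathbf v_1,\dots,\mathbf v_r$, let $d=r-n$, and let $\beta:\mathbb Z^r\to\mathbb Z^d\cong \operatorname{Cl}X$ be an integer matrix such that $0\to\mathbb Z^n\xrightarrow{\phi}\mathbb Z^r\xrightarrow{\beta}\mathbb Z^d\to0$ is exact. $L_\beta=\operatorname{im}\phi=\ker\beta\subseteq\mathbb Z^r$, a lattice of rank $n$. The Cox ring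 $S=\mathbb K[x_1,\dots,x_r]$ is graded by $\deg x_j=\beta_j$, the $j$-th column of $\beta$; "homogeneous" refers to this grading. For a sublattice $L\subseteq L_\beta$, the lattice ideal is $I_L=\langle \mathbf x^{\mathbf m^+}-\mathbf x^{\mathbf m^-} : \mathbf m=\mathbf m^+-\mathbf m^-\in L\rangle\subseteq S$, where $\mathbf m^{\pm}\in\mathbb N^r$ are the positive and negative parts of $\mathbf m$. $B\subseteq S$ is the monomial ideal generated by $\prod_{\rho_i\not\subseteq\sigma}x_i$, $\sigma\in\Sigma$. $G=\{P\in(\overline{\mathbb K}^* )^r : \mathbf x^{\mathbf m}(P)=1 \text{ for all } \mathbf m\in L_\beta\}$, where $\mathbf x^{\mathbf a}(P)=p_1^{a_1}\cdots p_r^{a_r}$. The points $X(\overline{\mathbb K})$ are identified with the $G$-orbits in $\overline{\mathbb K}^r\setminus V(B)$; $X(\mathbb K)$ is the set of orbits $[P]=G\cdot P$ with $P\in\mathbb K^r\setminus V(B)$; $T_X(\mathbb K)$ is the group (under coordinatewise multiplication) of orbits $[P]$ with $P\in(\mathbb K^* )^r$. For a homogeneous ideal $J$, $V_{X(\mathbb K)}(J)=\{[P]\in X(\mathbb K): F(P)=0\text{ for all homogeneous }F\in J\}$; when $L\subseteq L_\beta$ has rank $n$, $V_{X(\mathbb K)}(I_L)$ is a subgroup of $T_X(\mathbb K)$, and $\cong$ denotes isomorphism of groups. Invariant factors of $L_\beta/L$: the positive integers $d_1\mid d_2\mid\cdots\mid d_n$ (the value $1$ allowed) such that $L_\beta$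 has a basis $\mathbf m_1,\dots,\mathbf m_n$ with $d_1\mathbf m_1,\dots,d_n\mathbf m_n$ a basis of $L$.
   Formalization: "K has all the d_i-th roots of unity" is taken to mean that the algebraic closure has exactly d_i of them and all lie in K; without the count the equivalence fails when char K divides d_i (e.g. K = F_p, d_i = p). *)

theory Defs
  imports
    "HOL-Analysis.Analysis"
    "HOL-Library.Poly_Mapping"
    "HOL-Algebra.Coset"
    "HOL-Algebra.Product_Groups"
    "HOL-Algebra.Algebraic_Closure_Type"
begin

unbundle no fps_syntax

section \<open>Fans\<close>

definition real_vec :: "int ^ 'n \<Rightarrow> real ^ 'n" where
  "real_vec w = (\<chi> j. real_of_int (w $ j))"

definition rational_polyhedral_cone :: "(real ^ 'n) set \<Rightarrow> bool" where
  "rational_polyhedral_cone \<sigma> \<longleftrightarrow> (\<exists>A. finite A \<and> \<sigma> = convex_cone hull (real_vec ` A))"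

definition strongly_convex_cone :: "(real ^ 'n) set \<Rightarrow> bool" where
  "strongly_convex_cone \<sigma> \<longleftrightarrow> \<sigma> \<inter> uminus ` \<sigma> = {0}"

text \<open>The library counts the empty set as a face of every convex set; it is not a face of a
  cone in the sense of fans.\<close>

definition cone_face :: "(real ^ 'n) set \<Rightarrow> (real ^ 'n) set \<Rightarrow> bool" where
  "cone_face \<tau> \<sigma> \<longleftrightarrow> \<tau> face_of \<sigma> \<and> \<tau> \<noteq> {}"

definition is_fan :: "(real ^ 'n) set set \<Rightarrow> bool" where
  "is_fan \<Sigma> \<longleftrightarrow> finite \<Sigma> \<and> \<Sigma> \<noteq> {} \<and>
     (\<forall>\<sigma>\<in>\<Sigma>. rational_polyhedral_cone \<sigma> \<and> strongly_convex_cone \<sigma>) \<and>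
     (\<forall>\<sigma>\<in>\<Sigma>. \<forall>\<tau>. cone_face \<tau> \<sigma> \<longrightarrow> \<tau> \<in> \<Sigma>) \<and>
     (\<forall>\<sigma>\<in>\<Sigma>. \<forall>\<tau>\<in>\<Sigma>. cone_face (\<sigma> \<inter> \<tau>) \<sigma> \<and> cone_face (\<sigma> \<inter> \<tau>) \<tau>)"

definition complete_fan :: "(real ^ 'n) set set \<Rightarrow> bool" where
  "complete_fan \<Sigma> \<longleftrightarrow> is_fan \<Sigma> \<and> \<Union>\<Sigma> = UNIV"

definition simplicial_fan :: "(real ^ 'n) set set \<Rightarrow> bool" where
  "simplicial_fan \<Sigma> \<longleftrightarrow> is_fan \<Sigma> \<and>
     (\<forall>\<sigma>\<in>\<Sigma>. \<exists>A. independent A \<and> \<sigma> = convex_cone hull A)"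

definition fan_rays :: "(real ^ 'n) set set \<Rightarrow> (real ^ 'n) set set" where
  "fan_rays \<Sigma> = {\<rho>\<in>\<Sigma>. dim \<rho> = 1}"

definition primitive_vec :: "int ^ 'n \<Rightarrow> bool" where
  "primitive_vec w \<longleftrightarrow> Gcd (range (\<lambda>j. w $ j)) = 1"

definition ray_of :: "int ^ 'n \<Rightarrow> (real ^ 'n) set" where
  "ray_of w = convex_cone hull {real_vec w}"

text \<open>The rows of the matrix \<open>\<phi>\<close> are the primitive generators of the rays of \<open>\<Sigma>\<close>, each ray
  occurring exactly once.\<close>

definition ray_matrix :: "(real ^ 'n) set set \<Rightarrow> int ^ 'n ^ 'r \<Rightarrow> bool" where
  "ray_matrix \<Sigma> \<phi> \<longleftrightarrow> bij_betw (\<lambda>i. ray_of (\<phi> $ i)) UNIV (fan_rays \<Sigma>) \<and>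
     (\<forall>i. primitive_vec (\<phi> $ i))"

text \<open>Exactness of \<open>0 \<rightarrow> \<int>\<^sup>n \<rightarrow> \<int>\<^sup>r \<rightarrow> \<int>\<^sup>d \<rightarrow> 0\<close>. As the class group is the cokernel of
  \<open>\<phi>\<close>, this also says that it is free, of rank \<open>d\<close>.\<close>

definition short_exact :: "int ^ 'n ^ 'r \<Rightarrow> int ^ 'r ^ 'd \<Rightarrow> bool" where
  "short_exact \<phi> \<beta> \<longleftrightarrow> inj (\<lambda>u. \<phi> *v u) \<and> range (\<lambda>u. \<phi> *v u) = {m. \<beta> *v m = 0} \<and>
     surj (\<lambda>m. \<beta> *v m)"


section \<open>Lattices\<close>

text \<open>Here \<open>Modules.module\<close> is the locale of modules in the type class sense, with the scalar
  multiplication as its argument; \<open>Modules.module.span\<close>, for instance, is the submodule generated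
  by a set. Over \<open>\<int>\<close> with \<open>(*s)\<close> its submodules are sublattices, over a ring with \<open>(*)\<close> they
  are ideals.\<close>

lemma module_int_vec: "Modules.module ((*s) :: int \<Rightarrow> int ^ 'r \<Rightarrow> int ^ 'r)"
  by unfold_locales (auto simp: vec_eq_iff algebra_simps)

lemma module_ring: "Modules.module ((*) :: 'a::comm_ring_1 \<Rightarrow> 'a \<Rightarrow> 'a)"
  by unfold_locales (auto simp: algebra_simps)

definition sublattice :: "(int ^ 'r) set \<Rightarrow> bool" where
  "sublattice L \<longleftrightarrow> Modules.module.subspace (*s) L"

definition lattice_basis :: "nat \<Rightarrow> (nat \<Rightarrow> int ^ 'r) \<Rightarrow> (int ^ 'r) set \<Rightarrow> bool" where
  "lattice_basis k b L \<longleftrightarrow> inj_on b {1..k} \<and> \<not> Modules.module.dependent (*s) (b ` {1..k}) \<and>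
     Modules.module.span (*s) (b ` {1..k}) = L"

definition has_rank :: "(int ^ 'r) set \<Rightarrow> nat \<Rightarrow> bool" where
  "has_rank L k \<longleftrightarrow> (\<exists>b. lattice_basis k b L)"

text \<open>\<open>d 1, \<dots>, d n\<close> are the invariant factors of the quotient \<open>M / L\<close>.\<close>

definition invariant_factors ::
  "nat \<Rightarrow> (nat \<Rightarrow> nat) \<Rightarrow> (int ^ 'r) set \<Rightarrow> (int ^ 'r) set \<Rightarrow> bool" where
  "invariant_factors n d M L \<longleftrightarrow>
     (\<forall>i\<in>{1..n}. 0 < d i) \<and> (\<forall>i\<in>{1..<n}. d i dvd d (Suc i)) \<and>
     (\<exists>m. lattice_basis n m M \<and> lattice_basis n (\<lambda>i. int (d i) *s m i) L)"

definition L_beta :: "int ^ 'r ^ 'd \<Rightarrow> (int ^ 'r) set" where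
  "L_beta \<beta> = {m. \<beta> *v m = 0}"


section \<open>The Cox ring\<close>

type_synonym ('r, 'k) mpoly = "('r \<Rightarrow>\<^sub>0 nat) \<Rightarrow>\<^sub>0 'k"

definition Var :: "'r \<Rightarrow> ('r, 'k::comm_ring_1) mpoly" where
  "Var i = Poly_Mapping.single (Poly_Mapping.single i 1) 1"

definition eval_ac :: "('r::finite, 'k::field) mpoly \<Rightarrow> 'k alg_closure ^ 'r \<Rightarrow> 'k alg_closure" where
  "eval_ac F P = (\<Sum>a\<in>Poly_Mapping.keys F.
     to_ac (Poly_Mapping.lookup F a) * (\<Prod>i\<in>UNIV. (P $ i) ^ Poly_Mapping.lookup a i))"

text \<open>The degree of \<open>x\<^sub>j\<close> is the \<open>j\<close>-th column of \<open>\<beta>\<close>, so \<open>x\<^sup>a\<close> has degree \<open>\<beta> a\<close>.\<close>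

definition monom_degree :: "int ^ 'r ^ 'd \<Rightarrow> ('r \<Rightarrow>\<^sub>0 nat) \<Rightarrow> int ^ 'd" where
  "monom_degree \<beta> a = (\<Sum>j\<in>UNIV. int (Poly_Mapping.lookup a j) *s column j \<beta>)"

definition homogeneous :: "int ^ 'r ^ 'd \<Rightarrow> ('r, 'k::comm_ring_1) mpoly \<Rightarrow> bool" where
  "homogeneous \<beta> F \<longleftrightarrow> (\<exists>\<delta>. \<forall>a\<in>Poly_Mapping.keys F. monom_degree \<beta> a = \<delta>)"

definition ideal_generated :: "'a::comm_ring_1 set \<Rightarrow> 'a set" where
  "ideal_generated A = Modules.module.span (*) A"

text \<open>Since \<^const>\<open>nat\<close> sends negative integers to \<open>0\<close>, the two products below are
  \<open>x\<^sup>m\<close> for the positive and for the negative part of \<open>m\<close>.\<close>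

definition lattice_binomial :: "int ^ 'r \<Rightarrow> ('r, 'k::comm_ring_1) mpoly" where
  "lattice_binomial m = (\<Prod>i\<in>UNIV. Var i ^ nat (m $ i)) - (\<Prod>i\<in>UNIV. Var i ^ nat (- (m $ i)))"

definition lattice_ideal :: "(int ^ 'r) set \<Rightarrow> ('r, 'k::comm_ring_1) mpoly set" where
  "lattice_ideal L = ideal_generated (lattice_binomial ` L)"

definition irrelevant_ideal ::
  "(real ^ 'n) set set \<Rightarrow> int ^ 'n ^ 'r \<Rightarrow> ('r, 'k::comm_ring_1) mpoly set" where
  "irrelevant_ideal \<Sigma> \<phi> =
     ideal_generated ((\<lambda>\<sigma>. \<Prod>i\<in>{i. \<not> ray_of (\<phi> $ i) \<subseteq> \<sigma>}. Var i) ` \<Sigma>)"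

definition zero_set :: "('r::finite, 'k::field) mpoly set \<Rightarrow> ('k alg_closure ^ 'r) set" where
  "zero_set J = {P. \<forall>F\<in>J. eval_ac F P = 0}"


section \<open>Rational points of the toric variety\<close>

definition torus :: "('k::field alg_closure ^ 'r) monoid" where
  "torus = \<lparr>carrier = {P. \<forall>i. P $ i \<noteq> 0}, monoid.mult = (*), one = 1\<rparr>"

definition laurent_monomial :: "int ^ 'r \<Rightarrow> 'k::field alg_closure ^ 'r \<Rightarrow> 'k alg_closure" where
  "laurent_monomial m P = (\<Prod>i\<in>UNIV. (P $ i) powi (m $ i))"

definition cox_group :: "int ^ 'r ^ 'd \<Rightarrow> ('k::field alg_closure ^ 'r) set" where
  "cox_group \<beta> = {P \<in> carrier torus. \<forall>m\<in>L_beta \<beta>. laurent_monomial m P = 1}"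

definition orbit :: "int ^ 'r ^ 'd \<Rightarrow> 'k::field alg_closure ^ 'r \<Rightarrow> ('k alg_closure ^ 'r) set" where
  "orbit \<beta> P = (\<lambda>g. g * P) ` cox_group \<beta>"

definition rational_vecs :: "('k::field alg_closure ^ 'r) set" where
  "rational_vecs = {P. \<forall>i. P $ i \<in> range to_ac}"

definition X_points ::
  "(real ^ 'n) set set \<Rightarrow> int ^ 'n ^ 'r \<Rightarrow> int ^ 'r ^ 'd \<Rightarrow> ('k::field alg_closure ^ 'r) set set" where
  "X_points \<Sigma> \<phi> \<beta> = orbit \<beta> `
     (rational_vecs - zero_set (irrelevant_ideal \<Sigma> \<phi> :: ('r, 'k) mpoly set))"

text \<open>The product \<open>[P] [Q] = [P Q]\<close> of orbits is their elementwise product as sets.\<close>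

definition T_points :: "int ^ 'r ^ 'd \<Rightarrow> ('k::field alg_closure ^ 'r) set monoid" where
  "T_points \<beta> = \<lparr>carrier = orbit \<beta> ` (rational_vecs \<inter> carrier torus),
     monoid.mult = set_mult torus, one = orbit \<beta> 1\<rparr>"

lemma cox_mult: "P \<in> cox_group \<beta> \<Longrightarrow> Q \<in> cox_group \<beta> \<Longrightarrow> P * Q \<in> cox_group \<beta>"
  by (auto simp: cox_group_def torus_def laurent_monomial_def power_int_mult_distrib prod.distrib)

lemma cox_one: "1 \<in> cox_group \<beta>"
  by (auto simp: cox_group_def torus_def laurent_monomial_def)

lemma orbit_mult: "orbit \<beta> P <#>\<^bsub>torus\<^esub> orbit \<beta> Q = orbit \<beta> (P * Q)"
proof (intro equalityI subsetI)
  fix x assume "x \<in> orbit \<beta> P <#>\<^bsub>torus\<^esub> orbit \<beta> Q"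
  then obtain g h where "g \<in> cox_group \<beta>" "h \<in> cox_group \<beta>" "x = (g * P) * (h * Q)"
    by (auto simp: set_mult_def orbit_def torus_def)
  moreover from this have "x = (g * h) * (P * Q)" by (simp add: mult_ac)
  ultimately show "x \<in> orbit \<beta> (P * Q)" unfolding orbit_def by (blast intro: cox_mult)
next
  fix x assume "x \<in> orbit \<beta> (P * Q)"
  then obtain g where g: "g \<in> cox_group \<beta>" "x = g * (P * Q)" by (auto simp: orbit_def)
  hence "x = (g * P) * (1 * Q)" by (simp add: mult_ac)
  moreover have "g * P \<in> orbit \<beta> P" "1 * Q \<in> orbit \<beta> Q"
    using g cox_one unfolding orbit_def by blast+
  ultimately show "x \<in> orbit \<beta> P <#>\<^bsub>torus\<^esub> orbit \<beta> Q"
    by (auto simp: set_mult_def torus_def)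
qed

lemma comm_group_T_points: "comm_group (T_points \<beta> :: ('k::field alg_closure ^ 'r) set monoid)"
proof (rule comm_groupI)
  fix x :: "('k::field alg_closure ^ 'r) set" assume "x \<in> carrier (T_points \<beta>)"
  then obtain P where P: "x = orbit \<beta> P" "P \<in> rational_vecs" "P \<in> carrier torus"
    by (auto simp: T_points_def)
  let ?Q = "\<chi> i. inverse (P $ i)"
  have "?Q \<in> rational_vecs \<inter> carrier torus" using P
    by (auto simp: rational_vecs_def torus_def image_iff simp flip: to_ac_inverse)
      (metis to_ac_inverse)
  moreover have "?Q * P = 1" using P by (auto simp: torus_def vec_eq_iff)
  ultimately show "\<exists>y\<in>carrier (T_points \<beta>). y \<otimes>\<^bsub>T_points \<beta>\<^esub> x = \<one>\<^bsub>T_points \<beta>\<^esub>"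
    by (intro bexI[of _ "orbit \<beta> ?Q"]) (auto simp: T_points_def orbit_mult P)
next
  have "P * Q \<in> rational_vecs" if "P \<in> rational_vecs" "Q \<in> rational_vecs" for P Q :: "'k alg_closure ^ 'r"
    using that unfolding rational_vecs_def image_iff mem_Collect_eq vector_mult_component
    by (metis to_ac_mult UNIV_I)
  moreover have "P * Q \<in> carrier torus" if "P \<in> carrier torus" "Q \<in> carrier torus" for P Q :: "'k alg_closure ^ 'r"
    using that by (auto simp: torus_def)
  ultimately show "x \<otimes>\<^bsub>T_points \<beta>\<^esub> y \<in> carrier (T_points \<beta>)" if "x \<in> carrier (T_points \<beta>)" "y \<in> carrier (T_points \<beta>)"
    for x y :: "('k alg_closure ^ 'r) set"
    using that by (auto simp: T_points_def orbit_mult)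
next
  have "(1::'k alg_closure ^ 'r) \<in> rational_vecs \<inter> carrier torus"
    by (auto simp: rational_vecs_def torus_def)
  thus "\<one>\<^bsub>T_points \<beta>\<^esub> \<in> carrier (T_points \<beta> :: ('k alg_closure ^ 'r) set monoid)"
    by (auto simp: T_points_def)
qed (auto simp: T_points_def orbit_mult mult_ac)

text \<open>For homogeneous \<open>F\<close> the condition \<open>F(P) = 0\<close> depends only on the orbit of \<open>P\<close>.\<close>

definition V_points ::
  "(real ^ 'n) set set \<Rightarrow> int ^ 'n ^ 'r \<Rightarrow> int ^ 'r ^ 'd \<Rightarrow> ('r, 'k::field) mpoly set \<Rightarrow>
     ('k alg_closure ^ 'r) set set" where
  "V_points \<Sigma> \<phi> \<beta> J = {O' \<in> X_points \<Sigma> \<phi> \<beta>. \<forall>P\<in>O'. \<forall>F\<in>J. homogeneous \<beta> F \<longrightarrow> eval_ac F P = 0}"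

definition roots_of_unity_group :: "nat \<Rightarrow> 'k::field monoid" where
  "roots_of_unity_group e = \<lparr>carrier = {c. c \<noteq> 0 \<and> c ^ e = 1}, monoid.mult = (*), one = 1\<rparr>"

text \<open>A field has all the \<open>e\<close>-th roots of unity if there are \<open>e\<close> of them in its algebraic closure
  and all of these lie in the field itself. The count matters only if the characteristic divides
  \<open>e\<close>: then there are fewer than \<open>e\<close> roots, and the property fails by definition.\<close>

definition has_all_roots_of_unity :: "'k::field itself \<Rightarrow> nat \<Rightarrow> bool" where
  "has_all_roots_of_unity _ e \<longleftrightarrow>
     card {z :: 'k alg_closure. z ^ e = 1} = e \<and>
     {z :: 'k alg_closure. z ^ e = 1} \<subseteq> range to_ac"

end

theory Submission
  imports Defs
begin

no_notation fps_nth (infixl "$" 75)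

text \<open>A common zero of the lattice binomials of \<open>L\<close> off \<open>V(B)\<close> lies in the torus. If
  \<open>P \<notin> V(B)\<close>, the rays \<open>v\<^sub>i\<close> with \<open>P\<^sub>i = 0\<close> all lie in one strongly convex cone of the fan, so
  some integral \<open>u\<close> satisfies \<open>v\<^sub>i \<bullet> u > 0\<close> for all of them. As \<open>L\<close> has finite index in
  \<open>L\<^sub>\<beta>\<close>, a positive multiple \<open>m\<close> of \<open>\<phi> u\<close> lies in \<open>L\<close>. If there is a zero coordinate, then at
  \<open>P\<close> the monomial of the positive part of \<open>m\<close> vanishes and that of its negative part does not
  (lemma \<open>zeros_of_lattice_ideal_in_torus\<close>). On the torus, vanishing of the binomial of \<open>m\<close>
  means that the character \<open>x\<^sup>m\<close> takes the value \<open>1\<close>. Hence the rational points on the lattice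
  ideal are the orbits of the rational torus points \<open>P\<close> with \<open>x\<^sup>m(P) = 1\<close> for all \<open>m \<in> L\<close>
  (lemma \<open>V_points_lattice_ideal\<close>).

  The orbit of a torus point is determined by the values of the characters in \<open>L\<^sub>\<beta>\<close>, hence by
  its coordinates \<open>x\<^bsup>b\<^sub>i\<^esup>(P)\<close> for a basis \<open>b\<close> of \<open>L\<^sub>\<beta>\<close>. All nonzero coordinate values in the field
  occur: since \<open>\<beta>\<close> is surjective onto a free group, \<open>L\<^sub>\<beta>\<close> is a direct summand of \<open>\<int>\<^sup>r\<close>, so there
  are integer vectors \<open>a\<^sub>i\<close> dual to the \<open>b\<^sub>j\<close> (lemma \<open>dual_basis_exists\<close>), and the point
  \<open>\<Prod>\<^sub>i c\<^sub>i\<^bsup>a\<^sub>i\<^esup>\<close> has coordinates \<open>c\<close>. Choosing \<open>b\<close> adapted to \<open>L\<close>, so that the \<open>d\<^sub>i b\<^sub>i\<close> form a basis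
  of \<open>L\<close>, the condition on \<open>P\<close> becomes \<open>c\<^sub>i\<^bsup>d\<^sub>i\<^esup> = 1\<close>, which gives the isomorphism with the product
  of the groups of roots of unity. The remaining claims count roots of \<open>x\<^bsup>d\<^sub>i\<^esup> - 1\<close>: a product of
  numbers bounded by \<open>d\<^sub>i\<close> equals the product of the \<open>d\<^sub>i\<close> only if all factors agree.\<close>

section \<open>Laurent monomials as characters of the torus\<close>

interpretation int_vec: Modules.module "(*s) :: int \<Rightarrow> int ^ 'r \<Rightarrow> int ^ 'r"
  by (rule module_int_vec)

lemma torus_iff: "P \<in> carrier torus \<longleftrightarrow> (\<forall>i. P $ i \<noteq> 0)"
  by (simp add: torus_def)

lemma power_int_prod: "(\<Prod>i\<in>A. f i) powi n = (\<Prod>i\<in>A. (f i :: 'a::field) powi n)"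
  by (induction A rule: infinite_finite_induct) (auto simp: power_int_mult_distrib)

lemma power_int_sum:
  "(x :: 'a::field) \<noteq> 0 \<Longrightarrow> x powi (\<Sum>i\<in>A. f i) = (\<Prod>i\<in>A. x powi f i)"
  by (induction A rule: infinite_finite_induct) (auto simp: power_int_add)

lemma to_ac_power_int: "to_ac (x powi n) = to_ac x powi n"
  by (simp add: power_int_def)

lemma laurent_monomial_0: "laurent_monomial 0 P = 1"
  by (simp add: laurent_monomial_def)

lemma one_in_torus: "1 \<in> carrier torus"
  by (simp add: torus_iff)

lemma laurent_monomial_one: "laurent_monomial m 1 = 1"
  by (simp add: laurent_monomial_def)

lemma laurent_monomial_add:
  "P \<in> carrier torus \<Longrightarrow> laurent_monomial (m + m') P = laurent_monomial m P * laurent_monomial m' P"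
  by (simp add: laurent_monomial_def torus_iff power_int_add prod.distrib)

lemma laurent_monomial_scale: "laurent_monomial (a *s m) P = laurent_monomial m P powi a"
  by (simp add: laurent_monomial_def power_int_prod mult.commute[of a] power_int_mult)

lemma laurent_monomial_mult:
  "laurent_monomial m (P * Q) = laurent_monomial m P * laurent_monomial m Q"
  by (simp add: laurent_monomial_def power_int_mult_distrib prod.distrib)

lemma laurent_monomial_rational:
  assumes "P \<in> rational_vecs"
  shows "laurent_monomial m P \<in> range to_ac"
proof -
  obtain f where "\<And>i. P $ i = to_ac (f i)"
    using assms unfolding rational_vecs_def image_iff mem_Collect_eq by metis
  then have "laurent_monomial m P = to_ac (\<Prod>i\<in>UNIV. f i powi (m $ i))"
    by (simp add: laurent_monomial_def to_ac_prod to_ac_power_int)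
  then show ?thesis by blast
qed

text \<open>For torus points, \<open>m \<mapsto> x\<^sup>m(P)\<close> is a homomorphism from \<open>\<int>\<^sup>r\<close> to the multiplicative group, so
  the set where two such maps agree is a sublattice.\<close>

lemma laurent_monomials_agree_on_span:
  assumes P: "P \<in> carrier torus" and Q: "Q \<in> carrier torus"
    and "\<And>m. m \<in> B \<Longrightarrow> laurent_monomial m P = laurent_monomial m Q" "m \<in> int_vec.span B"
  shows "laurent_monomial m P = laurent_monomial m Q"
proof -
  let ?E = "{m. laurent_monomial m P = laurent_monomial m Q}"
  have "int_vec.subspace ?E"
    by (rule int_vec.subspaceI)
      (auto simp: laurent_monomial_0 laurent_monomial_add laurent_monomial_scale P Q)
  then show ?thesis using int_vec.span_minimal[of B ?E] assms by blast
qed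

lemma orbit_self: "P \<in> orbit \<beta> P"
  unfolding orbit_def by (rule image_eqI[of _ _ 1]) (simp_all add: cox_one)

text \<open>By definition the Cox group is the subgroup of the torus on which all characters in \<open>L\<^sub>\<beta>\<close> are
  trivial; apply this to the quotient \<open>P / Q\<close>.\<close>

lemma orbit_eq_iff:
  fixes P Q :: "'k::field alg_closure ^ 'r"
  assumes P: "P \<in> carrier torus" and Q: "Q \<in> carrier torus"
  shows "orbit \<beta> P = orbit \<beta> Q \<longleftrightarrow> (\<forall>m\<in>L_beta \<beta>. laurent_monomial m P = laurent_monomial m Q)"
proof
  assume "orbit \<beta> P = orbit \<beta> Q"
  then have "P \<in> orbit \<beta> Q" using orbit_self by blast
  then obtain g where g: "g \<in> cox_group \<beta>" "P = g * Q" by (auto simp: orbit_def)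
  then show "\<forall>m\<in>L_beta \<beta>. laurent_monomial m P = laurent_monomial m Q"
    by (auto simp: laurent_monomial_mult cox_group_def)
next
  assume eq: "\<forall>m\<in>L_beta \<beta>. laurent_monomial m P = laurent_monomial m Q"
  have sub: "orbit \<beta> P \<subseteq> orbit \<beta> Q"
    if P: "P \<in> carrier torus" and Q: "Q \<in> carrier torus"
      and eq: "\<forall>m\<in>L_beta \<beta>. laurent_monomial m P = laurent_monomial m Q"
    for P Q :: "'k alg_closure ^ 'r"
  proof -
    define g where "g = (\<chi> i. P $ i / Q $ i)"
    have gQ: "g * Q = P" using Q by (simp add: g_def vec_eq_iff torus_iff)
    have g: "g \<in> carrier torus" using P Q by (simp add: g_def torus_iff)
    have "laurent_monomial m g = 1" if "m \<in> L_beta \<beta>" for m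
    proof -
      have "laurent_monomial m g * laurent_monomial m Q = laurent_monomial m Q"
        using eq that by (simp flip: laurent_monomial_mult add: gQ)
      moreover have "laurent_monomial m Q \<noteq> 0"
        using Q by (simp add: laurent_monomial_def torus_iff)
      ultimately show ?thesis by simp
    qed
    then have gG: "g \<in> cox_group \<beta>" using g by (simp add: cox_group_def)
    show ?thesis
    proof
      fix x assume "x \<in> orbit \<beta> P"
      then obtain h where "h \<in> cox_group \<beta>" "x = h * P" by (auto simp: orbit_def)
      then show "x \<in> orbit \<beta> Q"
        unfolding orbit_def using gG
        by (intro image_eqI[of _ _ "h * g"]) (auto simp: gQ mult.assoc intro: cox_mult)
    qed
  qed
  show "orbit \<beta> P = orbit \<beta> Q"
    using sub[OF P Q eq] sub[OF Q P] eq by auto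
qed


section \<open>Evaluation of polynomials\<close>

text \<open>Every polynomial is a sum of terms. This reduces the multiplicativity of evaluation to
  single terms.\<close>

lemma poly_mapping_add_induct [case_names zero single add]:
  fixes F :: "'a \<Rightarrow>\<^sub>0 'b::monoid_add"
  assumes "Q 0" "\<And>a c. Q (Poly_Mapping.single a c)" "\<And>F G. Q F \<Longrightarrow> Q G \<Longrightarrow> Q (F + G)"
  shows "Q F"
proof (induction F rule: update_induct)
  case (update f a b)
  have "Poly_Mapping.update a b f = f + Poly_Mapping.single a b"
    by (rule poly_mapping_eqI)
      (use update in \<open>auto simp: lookup_update lookup_add lookup_single in_keys_iff\<close>)
  then show ?case using update assms by simp
qed (fact assms)

lemma eval_ac_superset:
  assumes "finite A" "Poly_Mapping.keys F \<subseteq> A"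
  shows "eval_ac F P = (\<Sum>a\<in>A. to_ac (Poly_Mapping.lookup F a) *
    (\<Prod>i\<in>UNIV. (P $ i) ^ Poly_Mapping.lookup a i))"
  unfolding eval_ac_def by (rule sum.mono_neutral_left) (use assms in \<open>auto simp: in_keys_iff\<close>)

lemma eval_ac_0: "eval_ac 0 P = 0"
  by (simp add: eval_ac_def)

lemma eval_ac_single: "eval_ac (Poly_Mapping.single a c) P =
    to_ac c * (\<Prod>i\<in>UNIV. (P $ i) ^ Poly_Mapping.lookup a i)"
  by (subst eval_ac_superset[of "{a}"]) auto

lemma eval_ac_add: "eval_ac (F + G) P = eval_ac F P + eval_ac G P"
proof -
  let ?A = "Poly_Mapping.keys F \<union> Poly_Mapping.keys G"
  show ?thesis
    using keys_add[of F G]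
    by (simp add: eval_ac_superset[of ?A] lookup_add sum.distrib distrib_right)
qed

lemma eval_ac_diff: "eval_ac (F - G) P = eval_ac F P - eval_ac G P"
  using eval_ac_add[of "F - G" G P] by simp

lemma eval_ac_mult: "eval_ac (F * G) P = eval_ac F P * eval_ac G P"
proof (induction F rule: poly_mapping_add_induct)
  case (single a c)
  show ?case
  proof (induction G rule: poly_mapping_add_induct)
    case (single b c')
    show ?case by (simp add: mult_single eval_ac_single lookup_add power_add prod.distrib)
  qed (simp_all add: eval_ac_0 eval_ac_add distrib_left)
qed (simp_all add: eval_ac_0 eval_ac_add distrib_right)

lemma eval_ac_1: "eval_ac 1 P = 1"
  using eval_ac_single[of 0 1 P] by simp

lemma eval_ac_prod: "eval_ac (\<Prod>i\<in>A. f i) P = (\<Prod>i\<in>A. eval_ac (f i) P)"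
  by (induction A rule: infinite_finite_induct) (auto simp: eval_ac_mult eval_ac_1)

lemma eval_ac_power: "eval_ac (F ^ k) P = eval_ac F P ^ k"
  by (induction k) (auto simp: eval_ac_mult eval_ac_1)

lemma eval_ac_Var: "eval_ac (Var i) P = P $ i"
proof -
  have "(\<Prod>j\<in>UNIV. (P $ j) ^ (1 when i = j)) = (\<Prod>j\<in>UNIV. if i = j then P $ j else 1)"
    by (rule prod.cong) (auto simp: when_def)
  then show ?thesis by (simp add: Var_def eval_ac_single lookup_single)
qed

lemma eval_ac_ideal_generated:
  assumes "F \<in> ideal_generated A" "\<And>G. G \<in> A \<Longrightarrow> eval_ac G P = 0"
  shows "eval_ac F P = 0"
proof -
  interpret R: Modules.module "(*) :: ('a, 'b) mpoly \<Rightarrow> _" by (rule module_ring)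
  have "R.subspace {F. eval_ac F P = 0}"
    by (rule R.subspaceI) (auto simp: eval_ac_0 eval_ac_add eval_ac_mult)
  then show ?thesis
    using R.span_minimal[of A "{F. eval_ac F P = 0}"] assms by (auto simp: ideal_generated_def)
qed

lemma generator_in_ideal: "F \<in> A \<Longrightarrow> F \<in> ideal_generated A"
  unfolding ideal_generated_def by (rule Modules.module.span_base[OF module_ring])

lemma eval_ac_lattice_binomial: "eval_ac (lattice_binomial m) P =
    (\<Prod>i\<in>UNIV. (P $ i) ^ nat (m $ i)) - (\<Prod>i\<in>UNIV. (P $ i) ^ nat (- (m $ i)))"
  by (simp add: lattice_binomial_def eval_ac_diff eval_ac_prod eval_ac_power eval_ac_Var)

text \<open>The two monomials of the binomial do not vanish at a torus point, and their quotient is \<open>x\<^sup>m\<close>.\<close>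

lemma lattice_binomial_vanishes_iff:
  fixes P :: "'k::field alg_closure ^ 'r"
  assumes "P \<in> carrier torus"
  shows "eval_ac (lattice_binomial m) P = 0 \<longleftrightarrow> laurent_monomial m P = 1"
proof -
  let ?p = "\<Prod>i\<in>UNIV. (P $ i) ^ nat (m $ i)" and ?q = "\<Prod>i\<in>UNIV. (P $ i) ^ nat (- (m $ i))"
  have "x powi k = x ^ nat k / x ^ nat (- k)" if "x \<noteq> 0" for x :: "'k alg_closure" and k
    using that by (simp add: power_int_def divide_simps)
  then have "laurent_monomial m P = ?p / ?q"
    using assms by (simp add: laurent_monomial_def torus_iff prod_dividef)
  moreover have "?q \<noteq> 0" using assms by (simp add: torus_iff)
  ultimately have "laurent_monomial m P = 1 \<longleftrightarrow> ?p = ?q" by simp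
  then show ?thesis by (simp add: eval_ac_lattice_binomial)
qed

lemma prod_Var_power: "(\<Prod>i\<in>A. Var i ^ e i) =
    Poly_Mapping.single (\<Sum>i\<in>A. Poly_Mapping.single i (e i)) (1 :: 'k::comm_ring_1)"
proof -
  have "Var i ^ k = Poly_Mapping.single (Poly_Mapping.single i k) (1 :: 'k)" for i :: 'a and k
    by (induction k) (auto simp: Var_def mult_single simp flip: single_add)
  then show ?thesis
    by (induction A rule: infinite_finite_induct) (auto simp: mult_single)
qed

text \<open>The degrees of the two monomials of the binomial differ by \<open>\<beta> m\<close>. Thus, for \<open>L \<subseteq> L\<^sub>\<beta>\<close>, the
  generators of the lattice ideal are among the homogeneous elements tested in \<^const>\<open>V_points\<close>.\<close>

lemma homogeneous_lattice_binomial: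
  fixes \<beta> :: "int ^ 'r ^ 'd"
  assumes "m \<in> L_beta \<beta>"
  shows "homogeneous \<beta> (lattice_binomial m :: ('r, 'k::comm_ring_1) mpoly)"
proof -
  define a where "a = (\<lambda>m :: int ^ 'r. \<Sum>i\<in>UNIV. Poly_Mapping.single i (nat (m $ i)))"
  have lookup: "Poly_Mapping.lookup (a m) j = nat (m $ j)" for m j
  proof -
    have "Poly_Mapping.lookup (a m) j = (\<Sum>i\<in>UNIV. if i = j then nat (m $ i) else 0)"
      unfolding a_def lookup_sum by (rule sum.cong) (auto simp: lookup_single when_def)
    then show ?thesis by simp
  qed
  have "monom_degree \<beta> (a m) - monom_degree \<beta> (a (- m)) = \<beta> *v m"
  proof -
    have "int (nat x) * c - int (nat (- x)) * c = c * x" for x c :: int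
      by (cases "x \<ge> 0") auto
    then show ?thesis
      by (simp add: vec_eq_iff monom_degree_def lookup column_def matrix_vector_mult_def
          flip: sum_subtractf)
  qed
  then have deg: "monom_degree \<beta> (a m) = monom_degree \<beta> (a (- m))"
    using assms by (simp add: L_beta_def)
  have "lattice_binomial m = Poly_Mapping.single (a m) 1 - Poly_Mapping.single (a (- m)) (1 :: 'k)"
    by (simp add: lattice_binomial_def prod_Var_power a_def)
  then have "Poly_Mapping.keys (lattice_binomial m :: ('r, 'k) mpoly) \<subseteq> {a m, a (- m)}"
    using keys_diff[of "Poly_Mapping.single (a m) (1 :: 'k)" "Poly_Mapping.single (a (- m)) 1"]
    by auto
  then show ?thesis
    unfolding homogeneous_def using deg by (intro exI[of _ "monom_degree \<beta> (a m)"]) auto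
qed


section \<open>Integral functionals positive on a cone\<close>

text \<open>If a convex combination of two nonzero points of \<open>\<sigma>\<close> is \<open>0\<close>, then one of them, scaled, lies in
  \<open>\<sigma> \<inter> -\<sigma>\<close>.\<close>

lemma strongly_convex_cone_Diff_0_convex:
  fixes \<sigma> :: "(real ^ 'n) set"
  assumes cone: "convex_cone \<sigma>" and strong: "strongly_convex_cone \<sigma>"
  shows "convex (\<sigma> - {0})"
proof (rule convexI)
  fix x y :: "real ^ 'n" and s t :: real
  assume x: "x \<in> \<sigma> - {0}" and y: "y \<in> \<sigma> - {0}" and st: "0 \<le> s" "0 \<le> t" "s + t = 1"
  have sx: "s *\<^sub>R x \<in> \<sigma>" and ty: "t *\<^sub>R y \<in> \<sigma>"
    using cone x y st by (auto intro: convex_cone_scaleR)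
  have "s *\<^sub>R x + t *\<^sub>R y \<noteq> 0"
  proof
    assume "s *\<^sub>R x + t *\<^sub>R y = 0"
    then have eq: "s *\<^sub>R x = - (t *\<^sub>R y)" by (simp add: eq_neg_iff_add_eq_0)
    then have "s *\<^sub>R x \<in> \<sigma> \<inter> uminus ` \<sigma>" using sx ty by blast
    then have "s *\<^sub>R x = 0" using strong unfolding strongly_convex_cone_def by blast
    moreover from this eq have "t *\<^sub>R y = 0" by simp
    ultimately show False using x y st by auto
  qed
  then show "s *\<^sub>R x + t *\<^sub>R y \<in> \<sigma> - {0}"
    using cone sx ty by (auto intro: convex_cone_add)
qed

text \<open>The convex hull of the \<open>w\<^sub>i\<close> is compact and avoids \<open>0\<close>, so some real functional \<open>a\<close> is bounded
  below on it by a positive \<open>b\<close>. Rounding a large multiple of \<open>a\<close> to an integral vector changes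
  its values on the \<open>w\<^sub>i\<close> by a bounded amount only.\<close>

lemma integral_functional_positive_on_cone:
  fixes w :: "'i \<Rightarrow> int ^ 'n"
  assumes cone: "convex_cone \<sigma>" and strong: "strongly_convex_cone \<sigma>"
    and fin: "finite I" and w: "\<And>i. i \<in> I \<Longrightarrow> real_vec (w i) \<in> \<sigma> - {0}"
  shows "\<exists>u :: int ^ 'n. \<forall>i\<in>I. (\<Sum>j\<in>UNIV. w i $ j * u $ j) > 0"
proof -
  let ?H = "convex hull ((\<lambda>i. real_vec (w i)) ` I)"
  have "?H \<subseteq> \<sigma> - {0}"
    using w by (intro hull_minimal strongly_convex_cone_Diff_0_convex[OF cone strong]) auto
  then have "0 \<notin> ?H" by blast
  moreover have "closed ?H"
    using fin by (intro compact_imp_closed finite_imp_compact_convex_hull) auto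
  ultimately obtain a b where ab: "0 < b" "\<And>x. x \<in> ?H \<Longrightarrow> a \<bullet> x > b"
    using separating_hyperplane_closed_0[OF convex_convex_hull] by blast
  \<comment> \<open>\<open>M\<close> bounds the rounding error at every \<open>w\<^sub>i\<close>, as each entry of \<open>u\<close> is off by at most \<open>1\<close>.\<close>
  define M where "M = (\<Sum>i\<in>I. \<Sum>j\<in>UNIV. \<bar>real_of_int (w i $ j)\<bar>)"
  obtain N :: nat where N: "M < real N * b" using ab(1) reals_Archimedean3 by blast
  define u :: "int ^ 'n" where "u = (\<chi> j. \<lfloor>real N * a $ j\<rfloor>)"
  show ?thesis
  proof (intro exI ballI)
    fix i assume i: "i \<in> I"
    have "a \<bullet> real_vec (w i) > b" using i by (intro ab(2) hull_inc) auto
    then have ip: "(\<Sum>j\<in>UNIV. a $ j * real_of_int (w i $ j)) > b"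
      by (simp add: inner_vec_def real_vec_def)
    have "(\<Sum>j\<in>UNIV. \<bar>real_of_int (w i $ j)\<bar>) \<le> M"
      unfolding M_def using fin i
      by (intro member_le_sum[of i I "\<lambda>i. \<Sum>j\<in>UNIV. \<bar>real_of_int (w i $ j)\<bar>"])
        (auto intro: sum_nonneg)
    then have "(\<Sum>j\<in>UNIV. \<bar>real_of_int (w i $ j)\<bar>) < real N * b" using N by simp
    also have "\<dots> \<le> real N * (\<Sum>j\<in>UNIV. a $ j * real_of_int (w i $ j))"
      using ip by (intro mult_left_mono) auto
    finally have "0 < (\<Sum>j\<in>UNIV. real_of_int (w i $ j) * (real N * a $ j) - \<bar>real_of_int (w i $ j)\<bar>)"
      by (simp add: sum_subtractf sum_distrib_left mult_ac)
    also have "\<dots> \<le> (\<Sum>j\<in>UNIV. real_of_int (w i $ j) * real_of_int (u $ j))"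
    proof (rule sum_mono)
      fix j
      have "\<bar>real N * a $ j - real_of_int (u $ j)\<bar> \<le> 1" by (simp add: u_def) linarith
      then have "\<bar>real_of_int (w i $ j)\<bar> * \<bar>real N * a $ j - real_of_int (u $ j)\<bar>
          \<le> \<bar>real_of_int (w i $ j)\<bar>" using mult_left_mono by fastforce
      then have "real_of_int (w i $ j) * (real N * a $ j - real_of_int (u $ j))
          \<le> \<bar>real_of_int (w i $ j)\<bar>" by (metis abs_ge_self abs_mult order_trans)
      then show "real_of_int (w i $ j) * (real N * a $ j) - \<bar>real_of_int (w i $ j)\<bar>
          \<le> real_of_int (w i $ j) * real_of_int (u $ j)" by (simp add: algebra_simps)
    qed
    also have "\<dots> = real_of_int (\<Sum>j\<in>UNIV. w i $ j * u $ j)" by simp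
    finally show "(\<Sum>j\<in>UNIV. w i $ j * u $ j) > 0" by linarith
  qed
qed

lemma primitive_real_vec_nonzero: "primitive_vec w \<Longrightarrow> real_vec w \<noteq> 0"
proof
  assume prim: "primitive_vec w" and "real_vec w = 0"
  then have "range (\<lambda>j. w $ j) = {0}" by (auto simp: real_vec_def vec_eq_iff)
  then show False using prim by (simp add: primitive_vec_def)
qed

text \<open>A point lies off \<open>V(B)\<close> exactly if its vanishing coordinates belong to rays of one cone: a
  point where all generators of an ideal vanish is a zero of the ideal.\<close>

lemma notin_zero_set_irrelevant_ideal_iff:
  fixes \<phi> :: "int ^ 'n ^ 'r"
  shows "P \<notin> zero_set (irrelevant_ideal \<Sigma> \<phi> :: ('r, 'k::field) mpoly set) \<longleftrightarrow>
    (\<exists>\<sigma>\<in>\<Sigma>. \<forall>i. \<not> ray_of (\<phi> $ i) \<subseteq> \<sigma> \<longrightarrow> P $ i \<noteq> 0)"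
proof -
  let ?g = "\<lambda>\<sigma>. \<Prod>i\<in>{i. \<not> ray_of (\<phi> $ i) \<subseteq> \<sigma>}. Var i :: ('r, 'k) mpoly"
  have "P \<in> zero_set (irrelevant_ideal \<Sigma> \<phi> :: ('r, 'k) mpoly set) \<longleftrightarrow>
      (\<forall>\<sigma>\<in>\<Sigma>. eval_ac (?g \<sigma>) P = 0)"
    unfolding zero_set_def irrelevant_ideal_def
    by (auto intro: generator_in_ideal elim!: eval_ac_ideal_generated)
  then show ?thesis by (auto simp: eval_ac_prod eval_ac_Var)
qed

text \<open>If some coordinate of \<open>P\<close> vanishes, the binomial of \<open>m = N \<phi> u\<close> does not vanish at \<open>P\<close>, where
  \<open>u\<close> is an integral functional positive on the rays \<open>v\<^sub>i\<close> with \<open>P\<^sub>i = 0\<close>: all these \<open>i\<close> have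
  \<open>m\<^sub>i > 0\<close>, so they occur in the first monomial and not in the second.\<close>

lemma zeros_of_lattice_ideal_in_torus:
  fixes \<phi> :: "int ^ 'n ^ 'r" and P :: "'k::field alg_closure ^ 'r"
  assumes fan: "is_fan \<Sigma>" and prim: "\<And>i. primitive_vec (\<phi> $ i)"
    and N: "N > 0" "\<And>u. N *s (\<phi> *v u) \<in> L"
    and P: "P \<notin> zero_set (irrelevant_ideal \<Sigma> \<phi> :: ('r, 'k) mpoly set)"
    and vanish: "\<And>m. m \<in> L \<Longrightarrow> eval_ac (lattice_binomial m) P = 0"
  shows "P \<in> carrier torus"
proof (rule ccontr)
  assume "P \<notin> carrier torus"
  then obtain i0 where i0: "P $ i0 = 0" by (auto simp: torus_iff)
  obtain \<sigma> where \<sigma>: "\<sigma> \<in> \<Sigma>" "\<And>i. P $ i = 0 \<Longrightarrow> ray_of (\<phi> $ i) \<subseteq> \<sigma>"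
    using P unfolding notin_zero_set_irrelevant_ideal_iff by blast
  have cone: "convex_cone \<sigma>" "strongly_convex_cone \<sigma>"
    using fan \<sigma>(1) by (auto simp: is_fan_def rational_polyhedral_cone_def convex_cone_convex_cone_hull)
  have in_cone: "real_vec (\<phi> $ i) \<in> \<sigma> - {0}" if "i \<in> {i. P $ i = 0}" for i
    using \<sigma>(2)[of i] that primitive_real_vec_nonzero[OF prim, of i]
    by (auto simp: ray_of_def dest: subsetD[OF _ hull_inc])
  obtain u where u: "\<And>i. P $ i = 0 \<Longrightarrow> (\<Sum>j\<in>UNIV. \<phi> $ i $ j * u $ j) > 0"
    using integral_functional_positive_on_cone[where w = "\<lambda>i. \<phi> $ i", OF cone finite in_cone] by blast
  define m where "m = N *s (\<phi> *v u)"
  have m: "m $ i > 0" if "P $ i = 0" for i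
    using u[OF that] N(1) by (simp add: m_def matrix_vector_mult_def)
  have "(\<Prod>i\<in>UNIV. (P $ i) ^ nat (m $ i)) = 0"
    using i0 m[OF i0] by (auto intro!: bexI[of _ i0])
  moreover have "(\<Prod>i\<in>UNIV. (P $ i) ^ nat (- (m $ i))) \<noteq> 0"
    using m by force
  ultimately have "eval_ac (lattice_binomial m) P \<noteq> 0"
    by (simp only: eval_ac_lattice_binomial) simp
  then show False using vanish N(2) by (simp add: m_def)
qed


section \<open>Bases of the lattice of relations\<close>

lemma lattice_basis_mem: "lattice_basis n b M \<Longrightarrow> i \<in> {1..n} \<Longrightarrow> b i \<in> M"
  using int_vec.span_base[of "b i" "b ` {1..n}"] by (simp add: lattice_basis_def)

text \<open>The quotient \<open>M / L\<close> is a sum of cyclic groups of orders \<open>d\<^sub>i\<close>, so their product annihilates it.\<close>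

lemma lattice_basis_multiple:
  assumes m: "lattice_basis n m M" and L: "lattice_basis n (\<lambda>i. int (d i) *s m i) L" and "x \<in> M"
  shows "int (\<Prod>i\<in>{1..n}. d i) *s x \<in> L"
proof -
  let ?N = "int (\<Prod>i\<in>{1..n}. d i)"
  have subL: "int_vec.subspace L"
    using L int_vec.subspace_span unfolding lattice_basis_def by blast
  have "int_vec.subspace {x. ?N *s x \<in> L}"
  proof (rule int_vec.subspaceI; unfold mem_Collect_eq)
    show "?N *s 0 \<in> L" using int_vec.subspace_0[OF subL] by simp
    show "?N *s (x + y) \<in> L" if "?N *s x \<in> L" "?N *s y \<in> L" for x y
      using int_vec.subspace_add[OF subL that] by (simp add: int_vec.scale_right_distrib)
    show "?N *s (c *s x) \<in> L" if "?N *s x \<in> L" for c x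
      using int_vec.subspace_scale[OF subL that] by (metis int_vec.scale_left_commute)
  qed
  moreover have "?N *s m i \<in> L" if "i \<in> {1..n}" for i
  proof -
    have "d i dvd (\<Prod>i\<in>{1..n}. d i)" using that by (intro dvd_prodI) auto
    then obtain k where "?N = int (d i) * k" unfolding dvd_def by (metis of_nat_mult)
    moreover have "k *s (int (d i) *s m i) \<in> L"
      by (rule int_vec.subspace_scale[OF subL lattice_basis_mem[OF L that]])
    ultimately show ?thesis by (simp only: int_vec.scale_scale mult.commute)
  qed
  ultimately have "int_vec.span (m ` {1..n}) \<subseteq> {x. ?N *s x \<in> L}"
    by (intro int_vec.span_minimal) auto
  then show ?thesis using m assms(3) by (auto simp: lattice_basis_def)
qed

lemma lattice_basis_coordinates:
  assumes "lattice_basis n b M" "x \<in> M"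
  obtains c where "x = (\<Sum>i\<in>{1..n}. c i *s b i)"
proof -
  have inj: "inj_on b {1..n}" using assms(1) by (simp add: lattice_basis_def)
  have "x \<in> range (\<lambda>u. \<Sum>v\<in>b ` {1..n}. u v *s v)"
    using assms int_vec.span_finite[of "b ` {1..n}"] by (simp add: lattice_basis_def)
  then obtain u where "x = (\<Sum>v\<in>b ` {1..n}. u v *s v)" by blast
  then have "x = (\<Sum>i\<in>{1..n}. u (b i) *s b i)" by (simp only: sum.reindex[OF inj] o_def)
  then show ?thesis by (rule that[of "\<lambda>i. u (b i)"])
qed

lemma lattice_basis_coordinates_zero:
  assumes "lattice_basis n b M" "(\<Sum>i\<in>{1..n}. c i *s b i) = 0" "i \<in> {1..n}"
  shows "c i = 0"
proof -
  have inj: "inj_on b {1..n}" using assms(1) by (simp add: lattice_basis_def)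
  let ?u = "\<lambda>v. c (the_inv_into {1..n} b v)"
  have "(\<Sum>v\<in>b ` {1..n}. ?u v *s v) = (\<Sum>i\<in>{1..n}. c i *s b i)"
    unfolding sum.reindex[OF inj] by (rule sum.cong) (simp_all only: o_def the_inv_into_f_f[OF inj])
  then have "?u (b i) = 0"
    using assms by (intro int_vec.independentD[of "b ` {1..n}"]) (auto simp: lattice_basis_def)
  then show ?thesis by (simp only: the_inv_into_f_f[OF inj assms(3)])
qed

lemma matrix_vector_mult_linear_combination:
  fixes A :: "int ^ 'n ^ 'm"
  shows "A *v (\<Sum>k\<in>K. c k *s x k) = (\<Sum>k\<in>K. c k *s (A *v x k))"
proof (induction K rule: infinite_finite_induct)
  case (insert k K)
  have "A *v (c k *s x k) = c k *s (A *v x k)"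
    by (simp add: vec_eq_iff matrix_vector_mult_def sum_distrib_left mult_ac)
  then show ?case using insert by (simp add: matrix_vector_right_distrib)
qed simp_all

text \<open>A section \<open>S\<close> of \<open>\<beta>\<close> gives the projection \<open>p = 1 - S \<beta>\<close> of \<open>\<int>\<^sup>r\<close> onto \<open>L\<^sub>\<beta>\<close>. The coordinates of
  \<open>p x\<close> with respect to the basis \<open>b\<close> are integral linear forms in \<open>x\<close>; these are the \<open>a\<^sub>i\<close>.\<close>

lemma dual_basis_exists:
  fixes \<beta> :: "int ^ 'r ^ 'd"
  assumes surj: "surj (\<lambda>m. \<beta> *v m)" and b: "lattice_basis n b (L_beta \<beta>)"
  obtains a :: "nat \<Rightarrow> int ^ 'r" where
    "\<And>i j. i \<in> {1..n} \<Longrightarrow> j \<in> {1..n} \<Longrightarrow>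
      (\<Sum>k\<in>UNIV. a i $ k * b j $ k) = (if i = j then 1 else 0)"
proof -
  obtain s where s: "\<And>y. \<beta> *v s y = y" using surj by (metis surjD)
  define S :: "int ^ 'd ^ 'r" where "S = (\<chi> k l. s (axis l 1) $ k)"
  have S: "\<beta> *v (S *v y) = y" for y
  proof -
    have "S *v y = (\<Sum>l\<in>UNIV. y $ l *s s (axis l 1))"
      by (simp add: vec_eq_iff S_def matrix_vector_mult_def mult.commute)
    then have "\<beta> *v (S *v y) = (\<Sum>l\<in>UNIV. y $ l *s axis l 1)" by (simp add: matrix_vector_mult_linear_combination s)
    also have "\<dots> = y" by (rule basis_expansion)
    finally show ?thesis .
  qed
  define p where "p x = x - S *v (\<beta> *v x)" for x
  have p_mem: "p x \<in> L_beta \<beta>" for x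
  proof -
    have "\<beta> *v p x = \<beta> *v x - \<beta> *v (S *v (\<beta> *v x))"
      by (simp add: p_def matrix_vector_mult_diff_distrib)
    then show ?thesis by (simp add: S L_beta_def)
  qed
  have "\<exists>c. p (axis k 1) = (\<Sum>i\<in>{1..n}. c i *s b i)" for k
    using lattice_basis_coordinates[OF b p_mem] by metis
  then obtain c where c: "\<And>k. p (axis k 1) = (\<Sum>i\<in>{1..n}. c k i *s b i)" by metis
  define a :: "nat \<Rightarrow> int ^ 'r" where "a i = (\<chi> k. c k i)" for i
  have expand: "p x = (\<Sum>i\<in>{1..n}. (\<Sum>k\<in>UNIV. a i $ k * x $ k) *s b i)" for x
  proof -
    have "p x = (\<Sum>k\<in>UNIV. x $ k *s p (axis k 1))"
    proof -
      have "S *v (\<beta> *v x) = (\<Sum>k\<in>UNIV. x $ k *s (S *v (\<beta> *v axis k 1)))"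
        using matrix_vector_mult_linear_combination[of "S" "\<lambda>k. x $ k" "\<lambda>k. \<beta> *v axis k 1" UNIV]
          matrix_vector_mult_linear_combination[of \<beta> "\<lambda>k. x $ k" "\<lambda>k. axis k 1" UNIV]
        by (simp add: basis_expansion)
      then show ?thesis
        by (simp add: p_def int_vec.scale_right_diff_distrib sum_subtractf basis_expansion)
    qed
    also have "\<dots> = (\<Sum>k\<in>UNIV. \<Sum>i\<in>{1..n}. (a i $ k * x $ k) *s b i)"
      by (simp add: c int_vec.scale_sum_right a_def mult.commute)
    also have "\<dots> = (\<Sum>i\<in>{1..n}. (\<Sum>k\<in>UNIV. a i $ k * x $ k) *s b i)"
      by (subst sum.swap) (simp add: int_vec.scale_sum_left)
    finally show ?thesis .
  qed
  show ?thesis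
  proof (rule that)
    fix i j assume i: "i \<in> {1..n}" and j: "j \<in> {1..n}"
    have "b j \<in> L_beta \<beta>" using lattice_basis_mem[OF b j] .
    then have "p (b j) = b j" by (simp add: p_def L_beta_def)
    moreover have delta: "(\<Sum>i\<in>{1..n}. (if i = j then 1 else 0) *s b i) = b j"
    proof -
      have "(\<Sum>i\<in>{1..n}. (if i = j then 1 else 0) *s b i) = (\<Sum>i\<in>{1..n}. if i = j then b i else 0)"
        by (rule sum.cong) auto
      then show ?thesis using j by simp
    qed
    moreover have "(\<Sum>i\<in>{1..n}. ((\<Sum>k\<in>UNIV. a i $ k * b j $ k) - (if i = j then 1 else 0)) *s b i)
        = p (b j) - b j"
      by (simp only: int_vec.scale_left_diff_distrib sum_subtractf expand delta)
    ultimately have "(\<Sum>i\<in>{1..n}. ((\<Sum>k\<in>UNIV. a i $ k * b j $ k) - (if i = j then 1 else 0)) *s b i) = 0"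
      by simp
    from lattice_basis_coordinates_zero[OF b this i]
    show "(\<Sum>k\<in>UNIV. a i $ k * b j $ k) = (if i = j then 1 else 0)" by simp
  qed
qed


section \<open>Roots of unity\<close>

lemma roots_of_unity_finite_card:
  assumes "e > 0"
  shows "finite {x :: 'a::field. x ^ e = 1}" and "card {x :: 'a. x ^ e = 1} \<le> e"
proof -
  let ?p = "Polynomial.monom 1 e - 1 :: 'a poly"
  have "Polynomial.coeff ?p e = 1" using assms by simp
  then have p: "?p \<noteq> 0" by (metis coeff_0 zero_neq_one)
  have set: "{x. x ^ e = 1} = {x. poly ?p x = 0}" by (simp add: poly_monom)
  show "finite {x :: 'a. x ^ e = 1}" unfolding set by (rule poly_roots_finite[OF p])
  have "card {x. poly ?p x = 0} \<le> Polynomial.degree ?p" by (rule card_poly_roots_bound[OF p])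
  also have "\<dots> \<le> e" by (rule degree_diff_le) (auto simp: degree_monom_le)
  finally show "card {x :: 'a. x ^ e = 1} \<le> e" by (simp add: set)
qed

lemma carrier_roots_of_unity_group:
  "e > 0 \<Longrightarrow> carrier (roots_of_unity_group e) = {c. c ^ e = 1}"
  by (auto simp: roots_of_unity_group_def zero_power)

lemma group_roots_of_unity_group: "group (roots_of_unity_group e)"
  by (rule groupI) (auto simp: roots_of_unity_group_def power_mult_distrib
      intro!: exI[of _ "inverse _"] simp: power_inverse)

text \<open>The embedding into the algebraic closure maps the \<open>e\<close>-th roots of unity of the field
  injectively into a set with at most \<open>e\<close> elements; if there are \<open>e\<close> of them, it hits all of it.\<close>

lemma has_all_roots_of_unity_iff:
  assumes "e > 0"
  shows "has_all_roots_of_unity TYPE('k::field) e \<longleftrightarrow>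
    card (carrier (roots_of_unity_group e :: 'k monoid)) = e"
proof -
  let ?K = "{c :: 'k. c ^ e = 1}" and ?A = "{z :: 'k alg_closure. z ^ e = 1}"
  note A = roots_of_unity_finite_card[OF assms, where 'a = "'k alg_closure"]
  have sub: "to_ac ` ?K \<subseteq> ?A" by (auto simp flip: to_ac_power)
  have card: "card (to_ac ` ?K) = card ?K"
    by (rule card_image) (auto simp: inj_on_def)
  show ?thesis unfolding has_all_roots_of_unity_def carrier_roots_of_unity_group[OF assms]
  proof
    assume "card ?A = e \<and> ?A \<subseteq> range to_ac"
    moreover from this have "?A \<subseteq> to_ac ` ?K" by (auto simp flip: to_ac_power)
    ultimately show "card ?K = e" using sub card by (metis subset_antisym)
  next
    assume K: "card ?K = e"
    then have "to_ac ` ?K = ?A"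
      using card_seteq[OF A(1) sub] A(2) card by simp
    then show "card ?A = e \<and> ?A \<subseteq> range to_ac" using K card by auto
  qed
qed

lemma prod_eq_prod_iff_of_le:
  fixes f g :: "'i \<Rightarrow> nat"
  assumes "finite I" "\<And>i. i \<in> I \<Longrightarrow> f i \<le> g i" "\<And>i. i \<in> I \<Longrightarrow> 0 < g i"
  shows "prod f I = prod g I \<longleftrightarrow> (\<forall>i\<in>I. f i = g i)"
proof
  assume eq: "prod f I = prod g I"
  show "\<forall>i\<in>I. f i = g i"
  proof (rule ballI, rule ccontr)
    fix i assume i: "i \<in> I" and "f i \<noteq> g i"
    then have lt: "f i < g i" using assms(2) by force
    have "prod f I = f i * prod f (I - {i})" using assms(1) i by (simp add: prod.remove)
    also have "\<dots> \<le> f i * prod g (I - {i})"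
      using assms(2) by (intro mult_left_mono prod_mono) auto
    also have "\<dots> < g i * prod g (I - {i})"
      using lt assms(3) by (intro mult_strict_right_mono prod_pos) auto
    also have "\<dots> = prod g I" using assms(1) i by (simp add: prod.remove)
    finally show False using eq by simp
  qed
qed simp


section \<open>The rational points on a lattice ideal\<close>

text \<open>The point \<open>\<Prod>\<^sub>i c\<^sub>i\<^bsup>a\<^sub>i\<^esup>\<close>: the image of \<open>c\<close> under the homomorphism of tori given by the exponent
  vectors \<open>a\<^sub>1, \<dots>, a\<^sub>n\<close>.\<close>

definition torus_point :: "nat \<Rightarrow> (nat \<Rightarrow> int ^ 'r) \<Rightarrow> (nat \<Rightarrow> 'k::field) \<Rightarrow> 'k alg_closure ^ 'r" where
  "torus_point n a c = (\<chi> k. \<Prod>i\<in>{1..n}. to_ac (c i) powi (a i $ k))"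

lemma torus_point_rational: "torus_point n a c \<in> rational_vecs"
  by (auto simp: torus_point_def rational_vecs_def simp flip: to_ac_power_int to_ac_prod)

lemma torus_point_in_torus:
  "(\<And>i. i \<in> {1..n} \<Longrightarrow> c i \<noteq> 0) \<Longrightarrow> torus_point n a c \<in> carrier torus"
  by (auto simp: torus_point_def torus_iff)

lemma torus_point_mult:
  "torus_point n a (\<lambda>i\<in>{1..n}. c i * c' i) = torus_point n a c * torus_point n a c'"
  by (simp add: torus_point_def vec_eq_iff power_int_mult_distrib flip: prod.distrib)

lemma laurent_monomial_torus_point:
  assumes "\<And>i. i \<in> {1..n} \<Longrightarrow> c i \<noteq> 0"
  shows "laurent_monomial m (torus_point n a c) =
    (\<Prod>i\<in>{1..n}. to_ac (c i) powi (\<Sum>k\<in>UNIV. a i $ k * m $ k))"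
proof -
  have "laurent_monomial m (torus_point n a c) =
      (\<Prod>k\<in>UNIV. \<Prod>i\<in>{1..n}. to_ac (c i) powi (a i $ k * m $ k))"
    by (simp add: laurent_monomial_def torus_point_def power_int_prod power_int_mult)
  also have "\<dots> = (\<Prod>i\<in>{1..n}. \<Prod>k\<in>UNIV. to_ac (c i) powi (a i $ k * m $ k))"
    by (rule prod.swap)
  also have "\<dots> = (\<Prod>i\<in>{1..n}. to_ac (c i) powi (\<Sum>k\<in>UNIV. a i $ k * m $ k))"
    using assms by (intro prod.cong) (auto simp: power_int_sum)
  finally show ?thesis .
qed

text \<open>Points off the torus are excluded by \<open>zeros_of_lattice_ideal_in_torus\<close>. At torus points only
  the generating binomials have to be tested, and their vanishing does not depend on the
  representative of the orbit, as \<open>L \<subseteq> L\<^sub>\<beta>\<close>.\<close>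

lemma V_points_lattice_ideal:
  fixes \<phi> :: "int ^ 'n ^ 'r" and \<beta> :: "int ^ 'r ^ 'd"
  assumes fan: "is_fan \<Sigma>" and prim: "\<And>i. primitive_vec (\<phi> $ i)"
    and N: "N > 0" "\<And>u. N *s (\<phi> *v u) \<in> L" and L: "L \<subseteq> L_beta \<beta>"
  shows "V_points \<Sigma> \<phi> \<beta> (lattice_ideal L :: ('r, 'k::field) mpoly set) =
    orbit \<beta> ` {P \<in> rational_vecs \<inter> carrier torus. \<forall>m\<in>L. laurent_monomial m P = 1}"
    (is "?V = ?W")
proof (intro equalityI subsetI)
  fix x assume "x \<in> ?V"
  then obtain P where P: "x = orbit \<beta> P" "P \<in> rational_vecs"
      "P \<notin> zero_set (irrelevant_ideal \<Sigma> \<phi> :: ('r, 'k) mpoly set)"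
    and v: "\<And>Q F. Q \<in> orbit \<beta> P \<Longrightarrow> F \<in> lattice_ideal L \<Longrightarrow> homogeneous \<beta> F \<Longrightarrow>
      eval_ac (F :: ('r, 'k) mpoly) Q = 0"
    unfolding V_points_def X_points_def by blast
  have vP: "eval_ac (lattice_binomial m) P = 0" if "m \<in> L" for m
    using that L by (auto intro!: v orbit_self homogeneous_lattice_binomial generator_in_ideal
        simp: lattice_ideal_def)
  have "P \<in> carrier torus"
    by (rule zeros_of_lattice_ideal_in_torus[OF fan prim N P(3) vP])
  then show "x \<in> ?W" using P vP lattice_binomial_vanishes_iff by blast
next
  fix x assume "x \<in> ?W"
  then obtain P where P: "x = orbit \<beta> P" "P \<in> rational_vecs" "P \<in> carrier torus"
      "\<And>m. m \<in> L \<Longrightarrow> laurent_monomial m P = 1" by blast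
  have "P \<notin> zero_set (irrelevant_ideal \<Sigma> \<phi> :: ('r, 'k) mpoly set)"
    unfolding notin_zero_set_irrelevant_ideal_iff
    using fan P(3) by (auto simp: is_fan_def torus_iff)
  moreover have "eval_ac F Q = 0"
    if "Q \<in> x" "F \<in> lattice_ideal L" for Q and F :: "('r, 'k) mpoly"
  proof -
    obtain g where g: "g \<in> cox_group \<beta>" "Q = g * P" using \<open>Q \<in> x\<close> P(1) by (auto simp: orbit_def)
    have "Q \<in> carrier torus" using g P(3) by (auto simp: cox_group_def torus_iff)
    moreover have "laurent_monomial m Q = 1" if "m \<in> L" for m
      using g P(4) that L by (auto simp: cox_group_def laurent_monomial_mult)
    ultimately show ?thesis
      using that(2) unfolding lattice_ideal_def
      by (elim eval_ac_ideal_generated) (auto simp: lattice_binomial_vanishes_iff)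
  qed
  ultimately show "x \<in> ?V" unfolding V_points_def X_points_def using P(1,2) by auto
qed

theorem theorem3p7:
  fixes \<Sigma> :: "(real ^ 'n) set set"
    and \<phi> :: "int ^ 'n ^ 'r"
    and \<beta> :: "int ^ 'r ^ 'd"
    and L :: "(int ^ 'r) set"
    and d :: "nat \<Rightarrow> nat"
    and C :: "nat \<Rightarrow> 'k::field monoid"
    and V :: "('k alg_closure ^ 'r) set set"
  assumes "complete_fan \<Sigma>" and "simplicial_fan \<Sigma>"
    and "ray_matrix \<Sigma> \<phi>"
    and "CARD('d) = CARD('r) - CARD('n)"
    and "short_exact \<phi> \<beta>"
    and "sublattice L" and "L \<subseteq> L_beta \<beta>" and "has_rank L CARD('n)"
    and "invariant_factors CARD('n) d (L_beta \<beta>) L"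
    and C_def: "\<And>i. C i = roots_of_unity_group (d i)"
    and V_def: "V = V_points \<Sigma> \<phi> \<beta> (lattice_ideal L :: ('r, 'k) mpoly set)"
  shows "subgroup V (T_points \<beta>)
    \<and> (T_points \<beta>)\<lparr>carrier := V\<rparr> \<cong> product_group {1..CARD('n)} C
    \<and> finite V \<and> card V = (\<Prod>i\<in>{1..CARD('n)}. card (carrier (C i)))
    \<and> (\<Prod>i\<in>{1..CARD('n)}. card (carrier (C i))) \<le> (\<Prod>i\<in>{1..CARD('n)}. d i)
    \<and> (card V = (\<Prod>i\<in>{1..CARD('n)}. d i) \<longleftrightarrow>
         (\<forall>i\<in>{1..CARD('n)}. has_all_roots_of_unity TYPE('k) (d i)))"
proof -
  define n where "n = CARD('n)"
  let ?I = "{1..n}"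
  have d_pos: "d i > 0" if "i \<in> ?I" for i
    using assms(9) that by (simp add: invariant_factors_def n_def)
  obtain b where b: "lattice_basis n b (L_beta \<beta>)" and Lb: "lattice_basis n (\<lambda>i. int (d i) *s b i) L"
    using assms(9) unfolding invariant_factors_def n_def by blast
  have spanM: "int_vec.span (b ` ?I) = L_beta \<beta>" using b by (simp add: lattice_basis_def)
  have spanL: "int_vec.span ((\<lambda>i. int (d i) *s b i) ` ?I) = L" using Lb by (simp add: lattice_basis_def)
  have b_mem: "b i \<in> L_beta \<beta>" if "i \<in> ?I" for i
    using lattice_basis_mem[OF b that] .
  obtain a where a: "\<And>i j. i \<in> ?I \<Longrightarrow> j \<in> ?I \<Longrightarrow>
      (\<Sum>k\<in>UNIV. a i $ k * b j $ k) = (if i = j then 1 else 0)"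
    using dual_basis_exists[OF _ b] assms(5) unfolding short_exact_def by metis

  let ?N = "int (\<Prod>i\<in>?I. d i)"
  have fan: "is_fan \<Sigma>" using assms(1) by (simp add: complete_fan_def)
  have prim: "primitive_vec (\<phi> $ i)" for i using assms(3) by (simp add: ray_matrix_def)
  have N_pos: "?N > 0" unfolding of_nat_0_less_iff using d_pos by (rule prod_pos)
  have range: "range (\<lambda>u. \<phi> *v u) = L_beta \<beta>"
    using assms(5) unfolding short_exact_def L_beta_def by blast
  have N_mem: "?N *s (\<phi> *v u) \<in> L" for u
    using lattice_basis_multiple[OF b Lb, of "\<phi> *v u"] range by blast
  have V: "V = orbit \<beta> ` {P \<in> rational_vecs \<inter> carrier torus. \<forall>m\<in>L. laurent_monomial m P = 1}"
    unfolding V_def by (rule V_points_lattice_ideal[OF fan prim N_pos N_mem assms(7)])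

  let ?G = "product_group ?I C"
  \<comment> \<open>The isomorphism, from the roots of unity to the orbits; its inverse is \<open>[P] \<mapsto> (x\<^bsup>b\<^sub>i\<^esup>(P))\<^sub>i\<close>.\<close>
  define h where "h c = orbit \<beta> (torus_point n a c)" for c :: "nat \<Rightarrow> 'k"
  have carrier_G: "carrier ?G = (\<Pi>\<^sub>E i\<in>?I. {c. c ^ d i = 1})"
    using d_pos by (auto simp: C_def carrier_roots_of_unity_group intro!: PiE_cong)
  have nz: "c i \<noteq> 0" if "c \<in> carrier ?G" "i \<in> ?I" for c i
  proof
    assume "c i = 0"
    moreover have "c i ^ d i = 1" using that unfolding carrier_G PiE_iff by blast
    ultimately show False using d_pos[OF that(2)] by (simp add: zero_power)
  qed
  have tp: "torus_point n a c \<in> carrier torus" if "c \<in> carrier ?G" for c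
    by (rule torus_point_in_torus) (rule nz[OF that])
  have coord: "laurent_monomial (b j) (torus_point n a c) = to_ac (c j)"
    if c: "c \<in> carrier ?G" and j: "j \<in> ?I" for c j
  proof -
    have "laurent_monomial (b j) (torus_point n a c) =
        (\<Prod>i\<in>?I. to_ac (c i) powi (\<Sum>k\<in>UNIV. a i $ k * b j $ k))"
      by (rule laurent_monomial_torus_point) (rule nz[OF c])
    also have "\<dots> = (\<Prod>i\<in>?I. if i = j then to_ac (c i) else 1)"
    proof (rule prod.cong)
      fix i assume i: "i \<in> ?I"
      show "to_ac (c i) powi (\<Sum>k\<in>UNIV. a i $ k * b j $ k) = (if i = j then to_ac (c i) else 1)"
        unfolding a[OF i j] by simp
    qed simp
    finally show ?thesis using j by simp
  qed

  have group_G: "group ?G" by (rule product_group) (simp add: C_def group_roots_of_unity_group)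
  have group_T: "group (T_points \<beta> :: ('k alg_closure ^ 'r) set monoid)"
    using comm_group_T_points comm_group.axioms(2) by blast
  have hom: "h \<in> hom ?G (T_points \<beta>)"
  proof (rule homI)
    show "h c \<in> carrier (T_points \<beta>)" if "c \<in> carrier ?G" for c
      using tp[OF that] torus_point_rational by (auto simp: h_def T_points_def)
    show "h (c \<otimes>\<^bsub>?G\<^esub> c') = h c \<otimes>\<^bsub>T_points \<beta>\<^esub> h c'" for c c'
      by (simp add: h_def T_points_def orbit_mult C_def roots_of_unity_group_def torus_point_mult
          del: One_nat_def)
  qed
  have inj: "inj_on h (carrier ?G)"
  proof (rule inj_onI)
    fix c c' assume c: "c \<in> carrier ?G" and c': "c' \<in> carrier ?G" and eq: "h c = h c'"
    have "c i = c' i" if "i \<in> ?I" for i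
    proof -
      have "laurent_monomial (b i) (torus_point n a c) = laurent_monomial (b i) (torus_point n a c')"
        using eq b_mem[OF that] unfolding h_def orbit_eq_iff[OF tp[OF c] tp[OF c']] by blast
      then show ?thesis using coord[OF c that] coord[OF c' that] by simp
    qed
    then show "c = c'" using c c' unfolding carrier_product_group by (rule PiE_ext[rotated 2])
  qed
  have image: "h ` carrier ?G = V"
  proof (intro equalityI subsetI)
    fix x assume "x \<in> h ` carrier ?G"
    then obtain c where c: "c \<in> carrier ?G" "x = h c" by blast
    have basis: "laurent_monomial m (torus_point n a c) = 1"
      if m: "m \<in> (\<lambda>i. int (d i) *s b i) ` ?I" for m
    proof -
      obtain i where i: "i \<in> ?I" "m = int (d i) *s b i" using m by blast
      have "c i ^ d i = 1" using c(1) i(1) unfolding carrier_G PiE_iff by blast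
      then show ?thesis
        by (simp add: i(2) laurent_monomial_scale coord[OF c(1) i(1)] flip: to_ac_power)
    qed
    have "laurent_monomial m (torus_point n a c) = 1" if "m \<in> L" for m
    proof -
      have "laurent_monomial m (torus_point n a c) = laurent_monomial m 1"
      proof (rule laurent_monomials_agree_on_span[OF tp[OF c(1)]])
        show "m \<in> int_vec.span ((\<lambda>i. int (d i) *s b i) ` ?I)" using that by (simp only: spanL)
      qed (simp_all only: basis laurent_monomial_one one_in_torus)
      then show ?thesis by (simp only: laurent_monomial_one)
    qed
    then show "x \<in> V" using c tp torus_point_rational unfolding V h_def by blast
  next
    fix x assume "x \<in> V"
    then obtain P where P: "x = orbit \<beta> P" "P \<in> rational_vecs" "P \<in> carrier torus"
        "\<And>m. m \<in> L \<Longrightarrow> laurent_monomial m P = 1" unfolding V by blast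
    \<comment> \<open>The characters take values in the field itself, because \<open>P\<close> is rational.\<close>
    define c where "c = (\<lambda>i\<in>?I. of_ac (laurent_monomial (b i) P))"
    have to_ac_c: "to_ac (c i) = laurent_monomial (b i) P" if "i \<in> ?I" for i
      using that laurent_monomial_rational[OF P(2)] by (simp add: c_def to_ac_of_ac)
    have "c i ^ d i = 1" if "i \<in> ?I" for i
    proof -
      have "int (d i) *s b i \<in> L" using lattice_basis_mem[OF Lb that] .
      then have "laurent_monomial (int (d i) *s b i) P = 1" by (rule P(4))
      then have "to_ac (c i ^ d i) = 1" by (simp add: laurent_monomial_scale to_ac_c[OF that])
      then show ?thesis by (simp only: to_ac_eq_1_iff)
    qed
    then have c: "c \<in> carrier ?G" unfolding carrier_G by (auto simp: c_def)
    let ?Q = "torus_point n a c"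
    have "laurent_monomial m P = laurent_monomial m ?Q" if "m \<in> L_beta \<beta>" for m
    proof (rule laurent_monomials_agree_on_span[OF P(3) tp[OF c]])
      show "m \<in> int_vec.span (b ` ?I)" using that by (simp only: spanM)
    next
      fix m assume "m \<in> b ` ?I"
      then obtain i where i: "i \<in> ?I" "m = b i" by blast
      then show "laurent_monomial m P = laurent_monomial m ?Q"
        by (simp only: coord[OF c i(1)] to_ac_c[OF i(1)])
    qed
    then have "x = h c" unfolding h_def P(1) orbit_eq_iff[OF P(3) tp[OF c]] by blast
    then show "x \<in> h ` carrier ?G" using c by blast
  qed

  have sub: "subgroup V (T_points \<beta>)"
    using group_hom.img_is_subgroup[of ?G "T_points \<beta>" h] group_G group_T hom image
    by (simp add: group_hom_def group_hom_axioms_def)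
  have "h \<in> iso ?G ((T_points \<beta>)\<lparr>carrier := V\<rparr>)"
    using hom inj image by (auto simp: iso_def hom_def bij_betw_def)
  then have iso: "(T_points \<beta>)\<lparr>carrier := V\<rparr> \<cong> ?G"
    using group.iso_sym[OF group_G] by (auto simp: is_iso_def)
  have le: "card (carrier (C i)) \<le> d i" and fin: "finite (carrier (C i))" if "i \<in> ?I" for i
    using d_pos[OF that] roots_of_unity_finite_card[OF d_pos[OF that]]
    by (simp_all add: C_def carrier_roots_of_unity_group)
  have finV: "finite V"
    unfolding image[symmetric] using fin by (auto intro!: finite_imageI finite_PiE)
  have cardV: "card V = (\<Prod>i\<in>?I. card (carrier (C i)))"
    unfolding image[symmetric] card_image[OF inj] by (simp add: card_PiE)
  have "card V = (\<Prod>i\<in>?I. d i) \<longleftrightarrow> (\<forall>i\<in>?I. card (carrier (C i)) = d i)"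
    unfolding cardV by (rule prod_eq_prod_iff_of_le) (use le d_pos in auto)
  also have "\<dots> \<longleftrightarrow> (\<forall>i\<in>?I. has_all_roots_of_unity TYPE('k) (d i))"
    using d_pos by (simp add: C_def has_all_roots_of_unity_iff)
  finally have "card V = (\<Prod>i\<in>?I. d i) \<longleftrightarrow> (\<forall>i\<in>?I. has_all_roots_of_unity TYPE('k) (d i))" .
  moreover have "(\<Prod>i\<in>?I. card (carrier (C i))) \<le> (\<Prod>i\<in>?I. d i)"
    using le by (intro prod_mono) auto
  ultimately show ?thesis using sub iso finV cardV unfolding n_def by blast
qed

end
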